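(* For all real numbers $a,b>0$ and $v\in(0,1)$, $$a\sharp_v b\le\left(a\sharp_v b\right)\sharp\left(a\nabla_v b\right)\le I_v(a,b)\le\left(a\nabla_{\frac{v}{2}}b\right)\sharp_v\left(a\nabla_{\frac{1+v}{2}}b\right)\le a\nabla_v b.$$
   Context: For real numbers $x,y>0$ and $w\in[0,1]$: $x\sharp_w y:=x^{1-w}y^w$ (weighted geometric mean), $x\nabla_w y:=(1-w)x+wy$ (weighted arithmetic mean), and $\sharp:=\sharp_{1/2}$. The weighted identric mean of $a,b>0$ with weight $v\in(0,1)$ is, for $a\neq b$, $$I_v(a,b):=\frac1e\left(a\nabla_v b\right)^{\frac{(1-2v)(a\nabla_v b)}{v(1-v)(b-a)}}\left(\frac{b^{\frac{vb}{1-v}}}{a^{\frac{(1-v)a}{v}}}\right)^{\frac{1}{b-a}},$$ and $I_v(a,a):=a$. *)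

theory Defs
  imports Complex_Main
begin

definition weighted_geometric_mean :: "real \<Rightarrow> real \<Rightarrow> real \<Rightarrow> real"
    ("(_ \<sharp>\<^bsub>_\<^esub> _)" [71, 0, 71] 70)
  where "x \<sharp>\<^bsub>w\<^esub> y = x powr (1 - w) * y powr w"

definition weighted_arithmetic_mean :: "real \<Rightarrow> real \<Rightarrow> real \<Rightarrow> real"
    ("(_ \<nabla>\<^bsub>_\<^esub> _)" [71, 0, 71] 70)
  where "x \<nabla>\<^bsub>w\<^esub> y = (1 - w) * x + w * y"

abbreviation geometric_mean :: "real \<Rightarrow> real \<Rightarrow> real"  (infix "\<sharp>" 70)
  where "x \<sharp> y \<equiv> x \<sharp>\<^bsub>1 / 2\<^esub> y"

(* Meaningful for a, b > 0 and 0 < v < 1 only; the weight is the first argument. *)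
definition weighted_identric_mean :: "real \<Rightarrow> real \<Rightarrow> real \<Rightarrow> real"
  where "weighted_identric_mean v a b =
    (if a = b then a
     else 1 / exp 1
       * (a \<nabla>\<^bsub>v\<^esub> b) powr (((1 - 2 * v) * (a \<nabla>\<^bsub>v\<^esub> b)) / (v * (1 - v) * (b - a)))
       * (b powr ((v * b) / (1 - v)) / a powr (((1 - v) * a) / v)) powr (1 / (b - a)))"

end

theory Submission
  imports Defs
begin

text \<open>
  All five quantities are positive, so the chain may be compared after taking logarithms. Let
  \<open>a \<noteq> b\<close>; otherwise every mean in the chain is \<open>a\<close>. Write
  \<open>m = a \<nabla>\<^bsub>v\<^esub> b\<close>, and let \<open>L(p, q)\<close> be the average of \<open>ln\<close> over the
  interval between \<open>p\<close> and \<open>q\<close>. The point \<open>m\<close> divides the interval between \<open>a\<close> and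
  \<open>b\<close> in the ratio \<open>v : (1 - v)\<close>, and collecting the terms in \<open>m * ln m\<close> shows that the
  opaque formula for the weighted identric mean says
  \<open>ln (weighted_identric_mean v a b) = (1 - v) * L(a, m) + v * L(m, b)\<close>
  (lemma \<open>ln_weighted_identric_mean\<close>).

  The two middle inequalities are now the Hermite--Hadamard inequality for the concave function
  \<open>ln\<close>, that is \<open>(ln p + ln q) / 2 \<le> L(p, q) \<le> ln ((p + q) / 2)\<close>
  (lemma \<open>ln_Hermite_Hadamard\<close>), applied on both subintervals and averaged with weights \<open>1 - v\<close> and \<open>v\<close>: the endpoint
  bounds add up to \<open>(ln (a \<sharp>\<^bsub>v\<^esub> b) + ln m) / 2\<close>, and the midpoints \<open>(a + m) / 2\<close>
  and \<open>(m + b) / 2\<close> are \<open>a \<nabla>\<^bsub>v / 2\<^esub> b\<close> and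
  \<open>a \<nabla>\<^bsub>(1 + v) / 2\<^esub> b\<close>. The two outer inequalities are the weighted inequality
  between the geometric and the arithmetic mean
  (lemma \<open>weighted_geometric_le_arithmetic_mean\<close>); for the last one, the \<open>v\<close>-weighted arithmetic
  mean of the two midpoints is again \<open>m\<close>.
\<close>

section \<open>Weighted means\<close>

lemma weighted_arithmetic_mean_pos:
  assumes "x > 0" "y > 0" "0 \<le> w" "w \<le> 1"
  shows "x \<nabla>\<^bsub>w\<^esub> y > 0"
proof (cases "w = 0")
  case False
  then show ?thesis using assms
    unfolding weighted_arithmetic_mean_def
    by (intro add_nonneg_pos mult_nonneg_nonneg mult_pos_pos) auto
qed (use assms in \<open>simp add: weighted_arithmetic_mean_def\<close>)

lemma weighted_geometric_mean_pos:
  assumes "x > 0" "y > 0"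
  shows "x \<sharp>\<^bsub>w\<^esub> y > 0"
  using assms by (simp add: weighted_geometric_mean_def)

lemma ln_weighted_geometric_mean:
  assumes "x > 0" "y > 0"
  shows "ln (x \<sharp>\<^bsub>w\<^esub> y) = ln x \<nabla>\<^bsub>w\<^esub> ln y"
  using assms by (simp add: weighted_geometric_mean_def weighted_arithmetic_mean_def ln_mult ln_powr)

lemma ln_geometric_mean:
  assumes "x > 0" "y > 0"
  shows "ln (x \<sharp> y) = (ln x + ln y) / 2"
  unfolding ln_weighted_geometric_mean[OF assms]
  by (simp add: weighted_arithmetic_mean_def field_simps)

lemma weighted_arithmetic_mean_mono:
  assumes "x \<le> x'" "y \<le> y'" "0 \<le> w" "w \<le> 1"
  shows "x \<nabla>\<^bsub>w\<^esub> y \<le> x' \<nabla>\<^bsub>w\<^esub> y'"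
  using assms unfolding weighted_arithmetic_mean_def
  by (intro add_mono mult_left_mono) auto

text \<open>
  The graph of \<open>ln\<close> lies below its tangent at the arithmetic mean; averaging this bound over
  \<open>x\<close> and \<open>y\<close> cancels the linear term.
\<close>

lemma weighted_geometric_le_arithmetic_mean:
  assumes "x > 0" "y > 0" "0 \<le> w" "w \<le> 1"
  shows "x \<sharp>\<^bsub>w\<^esub> y \<le> x \<nabla>\<^bsub>w\<^esub> y"
proof -
  define m where "m = x \<nabla>\<^bsub>w\<^esub> y"
  have m: "m > 0" unfolding m_def by (rule weighted_arithmetic_mean_pos[OF assms])
  have tangent: "ln z \<le> ln m + (z / m - 1)" if "z > 0" for z
    using ln_le_minus_one[of "z / m"] that m by (simp add: ln_div)
  have "ln (x \<sharp>\<^bsub>w\<^esub> y) = ln x \<nabla>\<^bsub>w\<^esub> ln y"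
    by (rule ln_weighted_geometric_mean[OF assms(1,2)])
  also have "\<dots> \<le> (ln m + (x / m - 1)) \<nabla>\<^bsub>w\<^esub> (ln m + (y / m - 1))"
    using assms by (intro weighted_arithmetic_mean_mono tangent)
  also have "\<dots> = ln m + ((x \<nabla>\<^bsub>w\<^esub> y) / m - 1)"
    using m by (simp add: weighted_arithmetic_mean_def field_simps)
  also have "\<dots> = ln m" using m by (simp add: m_def)
  finally show ?thesis
    using m weighted_geometric_mean_pos[OF assms(1,2)] by (simp add: m_def)
qed

section \<open>The Hermite-Hadamard inequality for the logarithm\<close>

text \<open>
  The mean value of \<open>ln\<close> over the interval between \<open>p\<close> and \<open>q\<close>, computed from the
  antiderivative \<open>x * ln x - x\<close>. It is the logarithm of the unweighted identric mean of
  distinct positive \<open>p\<close> and \<open>q\<close>.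
\<close>

definition ln_average :: "real \<Rightarrow> real \<Rightarrow> real"
  where "ln_average p q = (q * ln q - p * ln p) / (q - p) - 1"

lemma ln_average_commute: "ln_average p q = ln_average q p"
proof -
  have "(q * ln q - p * ln p) / (q - p) = (p * ln p - q * ln q) / (p - q)"
    by (metis minus_diff_eq minus_divide_divide)
  then show ?thesis by (simp add: ln_average_def)
qed

text \<open>
  Both Hermite-Hadamard bounds are equalities at \<open>q = p\<close> when multiplied by \<open>q - p\<close>. The
  difference of the two sides is nondecreasing in \<open>q\<close>, because its derivative is nonnegative by
  \<open>ln t \<le> t - 1\<close>, used at \<open>t = p / q\<close> for the endpoints and at
  \<open>t = 2 * q / (p + q)\<close> for the midpoint.
\<close>

lemma ln_endpoints_le_integral:
  fixes p q :: real
  assumes "0 < p" "p \<le> q"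
  shows "(q - p) * ((ln p + ln q) / 2) \<le> q * ln q - p * ln p - (q - p)"
proof -
  define f where "f x = x * ln x - p * ln p - (x - p) - (x - p) * ((ln p + ln x) / 2)" for x
  have "f p \<le> f q"
  proof (rule DERIV_nonneg_imp_nondecreasing[OF assms(2)])
    fix x assume "p \<le> x" "x \<le> q"
    with assms have x: "x > 0" by simp
    have "(f has_real_derivative (p / x - 1 - ln (p / x)) / 2) (at x)"
      unfolding f_def using x assms
      by (auto intro!: derivative_eq_intros simp: field_simps ln_div)
    moreover have "ln (p / x) \<le> p / x - 1"
      using x assms by (intro ln_le_minus_one) simp
    ultimately show "\<exists>y. (f has_real_derivative y) (at x) \<and> 0 \<le> y"
      by (intro exI[of _ "(p / x - 1 - ln (p / x)) / 2"]) simp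
  qed
  then show ?thesis by (simp add: f_def)
qed

lemma integral_le_ln_midpoint:
  fixes p q :: real
  assumes "0 < p" "p \<le> q"
  shows "q * ln q - p * ln p - (q - p) \<le> (q - p) * ln ((p + q) / 2)"
proof -
  define f where "f x = (x - p) * ln ((p + x) / 2) - (x * ln x - p * ln p - (x - p))" for x
  have "f p \<le> f q"
  proof (rule DERIV_nonneg_imp_nondecreasing[OF assms(2)])
    fix x assume "p \<le> x" "x \<le> q"
    with assms have x: "x > 0" by simp
    define t where "t = 2 * x / (p + x)"
    have t: "t > 0" using x assms by (simp add: t_def)
    have ln_t: "ln t = ln x - ln ((p + x) / 2)"
      using x assms by (simp add: t_def ln_div ln_mult)
    have t1: "t - 1 = (x - p) / (p + x)"
      using x assms by (simp add: t_def field_simps)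
    have "(f has_real_derivative (x - p) / (p + x) - (ln x - ln ((p + x) / 2))) (at x)"
      unfolding f_def using x assms
      by (auto intro!: derivative_eq_intros simp: add_pos_pos divide_simps)
         (simp add: algebra_simps)
    then have "(f has_real_derivative t - 1 - ln t) (at x)"
      by (simp only: ln_t t1)
    then show "\<exists>y. (f has_real_derivative y) (at x) \<and> 0 \<le> y"
      using ln_le_minus_one[OF t] by (intro exI[of _ "t - 1 - ln t"]) simp
  qed
  then show ?thesis by (simp add: f_def)
qed

lemma ln_Hermite_Hadamard:
  fixes p q :: real
  assumes "0 < p" "0 < q" "p \<noteq> q"
  shows "(ln p + ln q) / 2 \<le> ln_average p q" and "ln_average p q \<le> ln ((p + q) / 2)"
proof -
  have *: "(ln p + ln q) / 2 \<le> ln_average p q \<and> ln_average p q \<le> ln ((p + q) / 2)"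
    if "0 < p" "p < q" for p q
  proof -
    have "ln_average p q = (q * ln q - p * ln p - (q - p)) / (q - p)"
      using that by (simp add: ln_average_def diff_divide_distrib)
    then show ?thesis
      using ln_endpoints_le_integral[of p q] integral_le_ln_midpoint[of p q] that
      by (simp add: pos_le_divide_eq pos_divide_le_eq mult.commute)
  qed
  have "(ln p + ln q) / 2 \<le> ln_average p q \<and> ln_average p q \<le> ln ((p + q) / 2)"
    using *[of p q] *[of q p] assms
    by (cases "p < q") (auto simp: ln_average_commute[of p q] add.commute)
  then show "(ln p + ln q) / 2 \<le> ln_average p q" and "ln_average p q \<le> ln ((p + q) / 2)"
    by blast+
qed

section \<open>The weighted identric mean as an average of logarithms\<close>

lemma weighted_identric_mean_pos:
  assumes "a > 0" "b > 0" "0 < v" "v < 1"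
  shows "weighted_identric_mean v a b > 0"
  using assms weighted_arithmetic_mean_pos[of a b v]
  by (simp add: weighted_identric_mean_def)

text \<open>
  Since \<open>m - a = v * (b - a)\<close> and \<open>b - m = (1 - v) * (b - a)\<close>, the two averages have
  denominators proportional to \<open>b - a\<close>, and the coefficient of \<open>m * ln m\<close> in their weighted
  sum is \<open>((1 - v)\<^sup>2 - v\<^sup>2) / (v * (1 - v) * (b - a))\<close>, whose numerator is
  \<open>1 - 2 * v\<close>.
\<close>

lemma ln_weighted_identric_mean:
  fixes a b v :: real
  assumes "a > 0" "b > 0" "0 < v" "v < 1" "a \<noteq> b"
  defines "m \<equiv> a \<nabla>\<^bsub>v\<^esub> b"
  shows "ln (weighted_identric_mean v a b) = ln_average a m \<nabla>\<^bsub>v\<^esub> ln_average m b"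
proof -
  have m: "m > 0" unfolding m_def using assms by (intro weighted_arithmetic_mean_pos) auto
  have ma: "m - a = v * (b - a)" and bm: "b - m = (1 - v) * (b - a)"
    by (simp_all add: m_def weighted_arithmetic_mean_def algebra_simps)
  have ne: "b - a \<noteq> 0" "v \<noteq> 0" "1 - v \<noteq> 0" using assms by auto
  have "ln (weighted_identric_mean v a b)
      = - 1 + (1 - 2 * v) * m / (v * (1 - v) * (b - a)) * ln m
        + 1 / (b - a) * (v * b / (1 - v) * ln b - (1 - v) * a / v * ln a)"
    using assms(1,2,5) m
    by (simp add: weighted_identric_mean_def m_def[symmetric] ln_mult ln_div ln_powr)
  also have "\<dots> = - 1 + (1 - v) * ((m * ln m - a * ln a) / (v * (b - a)))
        + v * ((b * ln b - m * ln m) / ((1 - v) * (b - a)))"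
  proof -
    define d u A B M where "d = b - a" and "u = 1 - v"
      and "A = a * ln a" and "B = b * ln b" and "M = m * ln m"
    have "v \<noteq> 0" "u \<noteq> 0" "d \<noteq> 0" using ne by (auto simp: d_def u_def)
    moreover have "1 - 2 * v = (u - v) * (u + v)"
      by (simp add: u_def)
    ultimately have "(1 - 2 * v) / (v * u * d) * M + 1 / d * (v / u * B - u / v * A)
        = u * ((M - A) / (v * d)) + v * ((B - M) / (u * d))"
      by (simp add: divide_simps) (simp add: algebra_simps)
    then show ?thesis
      by (simp add: d_def u_def A_def B_def M_def algebra_simps)
  qed
  also have "\<dots> = ln_average a m \<nabla>\<^bsub>v\<^esub> ln_average m b"
    by (simp add: ln_average_def weighted_arithmetic_mean_def ma bm algebra_simps)
  finally show ?thesis .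
qed

lemma weighted_identric_mean_bounds:
  fixes a b v :: real
  assumes "a > 0" "b > 0" "0 < v" "v < 1" "a \<noteq> b"
  shows "(a \<sharp>\<^bsub>v\<^esub> b) \<sharp> (a \<nabla>\<^bsub>v\<^esub> b) \<le> weighted_identric_mean v a b"
    and "weighted_identric_mean v a b
      \<le> (a \<nabla>\<^bsub>v / 2\<^esub> b) \<sharp>\<^bsub>v\<^esub> (a \<nabla>\<^bsub>(1 + v) / 2\<^esub> b)"
proof -
  define m where "m = a \<nabla>\<^bsub>v\<^esub> b"
  have m: "m > 0" unfolding m_def using assms by (intro weighted_arithmetic_mean_pos) auto
  have "m - a = v * (b - a)" and "b - m = (1 - v) * (b - a)"
    by (simp_all add: m_def weighted_arithmetic_mean_def algebra_simps)
  then have ne: "a \<noteq> m" "m \<noteq> b" using assms by auto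
  have mid: "(a + m) / 2 = a \<nabla>\<^bsub>v / 2\<^esub> b" "(m + b) / 2 = a \<nabla>\<^bsub>(1 + v) / 2\<^esub> b"
    by (simp_all add: m_def weighted_arithmetic_mean_def field_simps)
  have I: "weighted_identric_mean v a b > 0"
    using assms by (intro weighted_identric_mean_pos)
  have lnI: "ln (weighted_identric_mean v a b) = ln_average a m \<nabla>\<^bsub>v\<^esub> ln_average m b"
    unfolding m_def using assms by (rule ln_weighted_identric_mean)
  have G: "a \<sharp>\<^bsub>v\<^esub> b > 0"
    using assms by (intro weighted_geometric_mean_pos)
  have "ln ((a \<sharp>\<^bsub>v\<^esub> b) \<sharp> m) = ((ln a + ln m) / 2) \<nabla>\<^bsub>v\<^esub> ((ln m + ln b) / 2)"
    unfolding ln_geometric_mean[OF G m] ln_weighted_geometric_mean[OF assms(1,2)]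
    by (simp add: weighted_arithmetic_mean_def field_simps)
  also have "\<dots> \<le> ln (weighted_identric_mean v a b)"
    unfolding lnI using assms m ne
    by (intro weighted_arithmetic_mean_mono ln_Hermite_Hadamard) auto
  finally show "(a \<sharp>\<^bsub>v\<^esub> b) \<sharp> (a \<nabla>\<^bsub>v\<^esub> b) \<le> weighted_identric_mean v a b"
    using I weighted_geometric_mean_pos[OF G m] by (simp add: m_def)
  have pos: "(a + m) / 2 > 0" "(m + b) / 2 > 0" using assms m by simp_all
  have "ln (weighted_identric_mean v a b) \<le> ln ((a + m) / 2) \<nabla>\<^bsub>v\<^esub> ln ((m + b) / 2)"
    unfolding lnI using assms m ne
    by (intro weighted_arithmetic_mean_mono ln_Hermite_Hadamard) auto
  also have "\<dots> = ln (((a + m) / 2) \<sharp>\<^bsub>v\<^esub> ((m + b) / 2))"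
    using ln_weighted_geometric_mean[OF pos] by simp
  finally show "weighted_identric_mean v a b
      \<le> (a \<nabla>\<^bsub>v / 2\<^esub> b) \<sharp>\<^bsub>v\<^esub> (a \<nabla>\<^bsub>(1 + v) / 2\<^esub> b)"
    unfolding mid[symmetric] using I weighted_geometric_mean_pos[OF pos] by simp
qed

section \<open>The chain of inequalities\<close>

theorem corollary2p3:
  fixes a b v :: real
  assumes "a > 0" and "b > 0" and "0 < v" and "v < 1"
  shows "a \<sharp>\<^bsub>v\<^esub> b \<le> (a \<sharp>\<^bsub>v\<^esub> b) \<sharp> (a \<nabla>\<^bsub>v\<^esub> b)
    \<and> (a \<sharp>\<^bsub>v\<^esub> b) \<sharp> (a \<nabla>\<^bsub>v\<^esub> b) \<le> weighted_identric_mean v a b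
    \<and> weighted_identric_mean v a b
        \<le> (a \<nabla>\<^bsub>v / 2\<^esub> b) \<sharp>\<^bsub>v\<^esub> (a \<nabla>\<^bsub>(1 + v) / 2\<^esub> b)
    \<and> (a \<nabla>\<^bsub>v / 2\<^esub> b) \<sharp>\<^bsub>v\<^esub> (a \<nabla>\<^bsub>(1 + v) / 2\<^esub> b) \<le> a \<nabla>\<^bsub>v\<^esub> b"
proof (cases "a = b")
  case True
  have arith: "a \<nabla>\<^bsub>w\<^esub> a = a" for w
    by (simp add: weighted_arithmetic_mean_def algebra_simps)
  have geom: "a \<sharp>\<^bsub>w\<^esub> a = a" for w
    using assms(1) by (simp add: weighted_geometric_mean_def powr_add[symmetric])
  have "weighted_identric_mean v a a = a"
    by (simp add: weighted_identric_mean_def)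
  then show ?thesis
    by (simp only: True[symmetric] arith geom order_refl simp_thms)
next
  case False
  let ?m = "a \<nabla>\<^bsub>v\<^esub> b" and ?g = "a \<sharp>\<^bsub>v\<^esub> b"
  let ?p = "a \<nabla>\<^bsub>v / 2\<^esub> b" and ?q = "a \<nabla>\<^bsub>(1 + v) / 2\<^esub> b"
  have m: "?m > 0" and pq: "?p > 0" "?q > 0"
    using assms by (auto intro!: weighted_arithmetic_mean_pos)
  have g: "?g > 0"
    using assms by (intro weighted_geometric_mean_pos)
  have "?g \<le> ?m"
    using assms by (intro weighted_geometric_le_arithmetic_mean) auto
  then have "ln ?g \<le> ln (?g \<sharp> ?m)"
    unfolding ln_geometric_mean[OF g m] using ln_mono[of ?g ?m] g by simp
  then have "?g \<le> ?g \<sharp> ?m"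
    using g weighted_geometric_mean_pos[OF g m] by simp
  moreover have "?p \<sharp>\<^bsub>v\<^esub> ?q \<le> ?p \<nabla>\<^bsub>v\<^esub> ?q"
    using pq assms by (intro weighted_geometric_le_arithmetic_mean) auto
  moreover have "?p \<nabla>\<^bsub>v\<^esub> ?q = ?m"
    by (simp add: weighted_arithmetic_mean_def field_simps)
  ultimately show ?thesis
    using weighted_identric_mean_bounds[OF assms False] by simp
qed

end
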